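(* Let $M\ge 1$ and $r$ be integers with $-M\le r\le M$. Consider the rank-two holomorphic vector bundle over $\mathbb{P}^1$ obtained by gluing two charts $\mathbb{C}^3$ with coordinates $(\gamma,w_1,w_2)$ and $(\beta,v_1,v_2)$ ($\gamma,\beta$ being the base coordinates on $\mathbb{P}^1$) along $\gamma\ne 0$, $\beta\neq 0$ by $$\beta=\gamma^{-1},\qquad v_1=\gamma^{-M+1}w_1,\qquad v_2=\gamma^{M+1}w_2+\gamma^{r+1}w_1 .$$ The addition of the perturbation term $\partial_{w_1}E(\gamma,w_1)=\gamma^{r+1}w_1$ changes the bundle from $\mathcal{O}(M-1)\oplus\mathcal{O}(-M-1)$ (the bundle given by the same formulas without the term $\gamma^{r+1}w_1$) to $\mathcal{O}(r-1)\oplus\mathcal{O}(-r-1)$; that is, the bundle defined by the displayed transition functions is isomorphic to $\mathcal{O}(r-1)\oplus\mathcal{O}(-r-1)$. In particular, for $r\ge 0$, the $M$-matrix model potential $$W(x_1,\dots,x_M)=\frac12\sum_{i=1}^{M-r}x_i\,x_{M-r+1-i}$$ is geometrically equivalent to the $r$-matrix model potential $W(x_1,\dots,x_r)=0$.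
   Context: Convention: a line bundle on $\mathbb{P}^1$ with fibre coordinates $w$ (over the chart with coordinate $\gamma$) and $v$ (over the chart with coordinate $\beta=\gamma^{-1}$) related by $v=\gamma^{-n}w$ is $\mathcal{O}(n)$. Geometry attached to a potential (Ferrari's construction). Let $M\ge 0$ and let $E(\gamma,w)=\sum_{i\in\mathbb{Z}}E_i(w)\gamma^i$ be a "geometric potential" (a Laurent expansion in $\gamma$ with entire coefficients $E_i$; for the present purposes $E_i$ are polynomials and the sum is finite). The associated $M$-matrix model potential is $$W(x_1,\dots,x_M)=\frac{1}{2\pi i}\oint_{C_0}\gamma^{-M-1}E\Big(\gamma,\sum_{i=1}^{M}x_i\gamma^{i-1}\Big)\,d\gamma ,$$ where $C_0$ is a small loop around $0$, i.e. $W$ is the coefficient of $\gamma^{M}$ in $E(\gamma,\sum_{i=1}^M x_i\gamma^{i-1})$. The associated geometry is the complex threefold $\widehat{\mathcal{M}}$ obtained by gluing two copies of $\mathbb{C}^3$, with coordinates $(\gamma,w_1,w_2)$ and $(\beta,v_1,v_2)$, by $$\beta=\gamma^{-1},\qquad v_1=\gamma^{-M+1}w_1,\qquad v_2=\gamma^{M+1}w_2+\partial_{w_1}E(\gamma,w_1).$$ Different $E$ with the same $W$ give the same geometry, so the geometry is regarded as attached to $W$. For $W=0$ one may take $E=0$, and the geometry is the total space of $\mathcal{O}(M-1)\oplus\mathcal{O}(-M-1)$; for $M=0$ the only potential is $W=0$. Two potentials (possibly in different numbers of variables) are called geometrically equivalent if they yield the same geometry $\widehat{\mathcal{M}}$ (up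 to isomorphism) under this construction. *)

theory Defs
  imports "HOL-Complex_Analysis.Complex_Analysis"
begin

type_synonym c3 = "complex \<times> complex \<times> complex"

section \<open>Holomorphic maps in three complex variables\<close>

definition cscale :: "complex \<Rightarrow> c3 \<Rightarrow> c3" where
  "cscale c = (\<lambda>(x, y, z). (c * x, c * y, c * z))"

text \<open>Holomorphy means a complex-linear Frechet derivative at every point; only used for open sets.\<close>

definition holomorphic3_on :: "(c3 \<Rightarrow> c3) \<Rightarrow> c3 set \<Rightarrow> bool" where
  "holomorphic3_on f S \<longleftrightarrow>
     (\<forall>p\<in>S. \<exists>D. (f has_derivative D) (at p) \<and> (\<forall>c h. D (cscale c h) = cscale c (D h)))"

section \<open>Spaces glued from two copies of the affine chart\<close>

text \<open>A gluing map \<open>T\<close> identifies the point \<open>x = (\<gamma>, w\<^sub>1, w\<^sub>2)\<close> of the first chart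
  (\<open>Inl\<close>) with the point \<open>T x = (\<beta>, v\<^sub>1, v\<^sub>2)\<close> of the second chart (\<open>Inr\<close>) whenever
  \<open>\<gamma> \<noteq> 0\<close>; the values of \<open>T\<close> at \<open>\<gamma> = 0\<close> are irrelevant.\<close>

definition glue_rel :: "(c3 \<Rightarrow> c3) \<Rightarrow> (c3 + c3) rel" where
  "glue_rel T = Id \<union> {(Inl x, Inr (T x)) | x. fst x \<noteq> 0} \<union> {(Inr (T x), Inl x) | x. fst x \<noteq> 0}"

lemma equiv_glue_rel:
  assumes "inj_on T {x. fst x \<noteq> 0}"
  shows "equiv UNIV (glue_rel T)"
proof (rule equivI)
  show "refl (glue_rel T)" by (auto simp: glue_rel_def refl_on_def)
  show "sym (glue_rel T)" by (auto simp: glue_rel_def sym_def)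
  have "x = y" if "T x = T y" "fst x \<noteq> 0" "fst y \<noteq> 0" for x y
    using assms that by (blast dest: inj_onD)
  then show "trans (glue_rel T)"
    unfolding glue_rel_def trans_def by blast
qed auto

definition glued :: "(c3 \<Rightarrow> c3) \<Rightarrow> (c3 + c3) set set" where
  "glued T = UNIV // glue_rel T"

definition glued_point :: "(c3 \<Rightarrow> c3) \<Rightarrow> c3 + c3 \<Rightarrow> (c3 + c3) set" where
  "glued_point T s = glue_rel T `` {s}"

text \<open>A map of glued spaces is holomorphic if it is so in all pairs of charts. Openness of the
  domain \<open>S\<close> of each local expression is what encodes continuity for the quotient topology.\<close>

definition holomorphic_map ::
    "(c3 \<Rightarrow> c3) \<Rightarrow> (c3 \<Rightarrow> c3) \<Rightarrow> ((c3 + c3) set \<Rightarrow> (c3 + c3) set) \<Rightarrow> bool" where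
  "holomorphic_map T T' F \<longleftrightarrow> F ` glued T \<subseteq> glued T' \<and>
     (\<forall>i\<in>{Inl, Inr}. \<forall>j\<in>{Inl, Inr}.
        let S = {x. \<exists>y. F (glued_point T (i x)) = glued_point T' (j y)}
        in open S \<and>
           (\<exists>f. holomorphic3_on f S \<and>
              (\<forall>x\<in>S. F (glued_point T (i x)) = glued_point T' (j (f x)))))"

definition biholomorphism ::
    "(c3 \<Rightarrow> c3) \<Rightarrow> (c3 \<Rightarrow> c3) \<Rightarrow> ((c3 + c3) set \<Rightarrow> (c3 + c3) set) \<Rightarrow> bool" where
  "biholomorphism T T' F \<longleftrightarrow> bij_betw F (glued T) (glued T') \<and>
     holomorphic_map T T' F \<and> holomorphic_map T' T (inv_into (glued T) F)"

definition biholomorphic :: "(c3 \<Rightarrow> c3) \<Rightarrow> (c3 \<Rightarrow> c3) \<Rightarrow> bool" where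
  "biholomorphic T T' \<longleftrightarrow> (\<exists>F. biholomorphism T T' F)"

section \<open>Rank-two vector bundles over the projective line\<close>

text \<open>Here \<open>T\<close> and \<open>T'\<close> are meant to be of the form \<open>(\<gamma>, w) \<mapsto> (1 / \<gamma>, G(\<gamma>) w)\<close> with
  \<open>G(\<gamma>)\<close> an invertible matrix, so that the first coordinate is the base coordinate. An
  isomorphism of bundles is a biholomorphism of the total spaces which covers the identity of the
  base and is linear on fibres. As the base point is preserved, both properties can be read off
  from the expression of the map in corresponding charts.\<close>

definition bundle_isomorphic :: "(c3 \<Rightarrow> c3) \<Rightarrow> (c3 \<Rightarrow> c3) \<Rightarrow> bool" where
  "bundle_isomorphic T T' \<longleftrightarrow> (\<exists>F. biholomorphism T T' F \<and>
     (\<forall>i\<in>{Inl, Inr}. \<forall>z. \<exists>a b c d. \<forall>u1 u2.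
        F (glued_point T (i (z, u1, u2))) =
        glued_point T' (i (z, a * u1 + b * u2, c * u1 + d * u2))))"

text \<open>Transition function of \<open>\<O>(n)\<close>, in the convention \<open>v = \<gamma>\<^sup>-\<^sup>n w\<close>.\<close>

definition line_bundle :: "int \<Rightarrow> complex \<Rightarrow> complex" where
  "line_bundle n \<gamma> = \<gamma> powi (- n)"

definition direct_sum :: "(complex \<Rightarrow> complex) \<Rightarrow> (complex \<Rightarrow> complex) \<Rightarrow> c3 \<Rightarrow> c3" where
  "direct_sum g h = (\<lambda>(\<gamma>, w1, w2). (inverse \<gamma>, g \<gamma> * w1, h \<gamma> * w2))"

section \<open>Geometries attached to matrix model potentials\<close>

text \<open>In the geometry of a geometric potential \<open>E\<close>, the perturbation term \<open>e\<close> is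
  \<open>\<partial>E/\<partial>w\<^sub>1\<close>.\<close>

definition ferrari_gluing :: "nat \<Rightarrow> (complex \<Rightarrow> complex \<Rightarrow> complex) \<Rightarrow> c3 \<Rightarrow> c3" where
  "ferrari_gluing M e = (\<lambda>(\<gamma>, w1, w2).
     (inverse \<gamma>, \<gamma> powi (- int M + 1) * w1, \<gamma> powi (int M + 1) * w2 + e \<gamma> w1))"

lemma equiv_glue_rel_ferrari: "equiv UNIV (glue_rel (ferrari_gluing M e))"
  by (rule equiv_glue_rel) (auto simp: inj_on_def ferrari_gluing_def)

lemma equiv_glue_rel_direct_sum:
  "equiv UNIV (glue_rel (direct_sum (line_bundle m) (line_bundle n)))"
  by (rule equiv_glue_rel) (auto simp: inj_on_def direct_sum_def line_bundle_def)

text \<open>A geometric potential \<open>E(\<gamma>, w) = \<Sum>\<^sub>i E\<^sub>i(w) \<gamma>\<^sup>i\<close> is given by its finitely supported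
  family of polynomial coefficients.\<close>

definition geometric_potential :: "(int \<Rightarrow> complex poly) \<Rightarrow> bool" where
  "geometric_potential E \<longleftrightarrow> finite {i. E i \<noteq> 0}"

definition potential_value :: "(int \<Rightarrow> complex poly) \<Rightarrow> complex \<Rightarrow> complex \<Rightarrow> complex" where
  "potential_value E \<gamma> w = (\<Sum>i | E i \<noteq> 0. poly (E i) w * \<gamma> powi i)"

text \<open>The residue is by definition \<open>1 / (2 \<pi> \<i>)\<close> times the integral over all sufficiently small
  circles around \<open>0\<close>. Only the values \<open>x\<^sub>1, \<dots>, x\<^sub>M\<close> of the argument \<open>x\<close> matter.\<close>

definition matrix_potential ::
    "nat \<Rightarrow> (int \<Rightarrow> complex poly) \<Rightarrow> (nat \<Rightarrow> complex) \<Rightarrow> complex" where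
  "matrix_potential M E x =
     residue (\<lambda>\<gamma>. \<gamma> powi (- int M - 1) * potential_value E \<gamma> (\<Sum>i=1..M. x i * \<gamma> ^ (i - 1))) 0"

definition geometry :: "nat \<Rightarrow> (int \<Rightarrow> complex poly) \<Rightarrow> c3 \<Rightarrow> c3" where
  "geometry M E = ferrari_gluing M (\<lambda>\<gamma>. deriv (potential_value E \<gamma>))"

text \<open>The geometry depends only on the matrix model potential and not on the choice of a
  geometric potential yielding it, whence the existential quantifiers.\<close>

definition geometrically_equivalent ::
    "nat \<Rightarrow> ((nat \<Rightarrow> complex) \<Rightarrow> complex) \<Rightarrow> nat \<Rightarrow> ((nat \<Rightarrow> complex) \<Rightarrow> complex) \<Rightarrow> bool" where
  "geometrically_equivalent M W M' W' \<longleftrightarrow>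
     (\<exists>E E'. geometric_potential E \<and> matrix_potential M E = W \<and>
        geometric_potential E' \<and> matrix_potential M' E' = W' \<and>
        biholomorphic (geometry M E) (geometry M' E'))"

end

theory Submission
  imports Defs
begin

text \<open>With \<open>w\<^sub>1' = - w\<^sub>2\<close>, \<open>w\<^sub>2' = w\<^sub>1 + \<gamma>\<^sup>M\<^sup>-\<^sup>r w\<^sub>2\<close> over the first chart and
  \<open>v\<^sub>1' = v\<^sub>1 - \<beta>\<^sup>M\<^sup>+\<^sup>r v\<^sub>2\<close>, \<open>v\<^sub>2' = v\<^sub>2\<close> over the second one, the perturbed
  transition functions become \<open>v\<^sub>1' = \<gamma>\<^sup>1\<^sup>-\<^sup>r w\<^sub>1'\<close> and \<open>v\<^sub>2' = \<gamma>\<^sup>r\<^sup>+\<^sup>1 w\<^sub>2'\<close>. Both changes of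
  frame are polynomial with determinant \<open>1\<close> exactly because \<open>- M \<le> r \<le> M\<close>. The potential
  arises from \<open>E = \<gamma>\<^sup>r\<^sup>+\<^sup>1 w\<^sup>2 / 2\<close>.\<close>

section \<open>Holomorphic maps\<close>

lemma holomorphic3_on_compose:
  assumes f: "holomorphic3_on f S" and g: "holomorphic3_on g S'" and "f ` S \<subseteq> S'"
  shows "holomorphic3_on (\<lambda>x. g (f x)) S"
  unfolding holomorphic3_on_def
proof
  fix p assume p: "p \<in> S"
  obtain D where D: "(f has_derivative D) (at p)" "\<And>c h. D (cscale c h) = cscale c (D h)"
    using f p unfolding holomorphic3_on_def by blast
  have "f p \<in> S'" using p assms(3) by blast
  then obtain D' where D': "(g has_derivative D') (at (f p))" "\<And>c h. D' (cscale c h) = cscale c (D' h)"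
    using g unfolding holomorphic3_on_def by blast
  have "((\<lambda>x. g (f x)) has_derivative (\<lambda>h. D' (D h))) (at p)"
    using has_derivative_compose[OF D(1) D'(1)] .
  then show "\<exists>D. ((\<lambda>x. g (f x)) has_derivative D) (at p) \<and> (\<forall>c h. D (cscale c h) = cscale c (D h))"
    by (intro exI[of _ "\<lambda>h. D' (D h)"]) (simp add: D(2) D'(2))
qed

lemma holomorphic3_on_subset:
  "holomorphic3_on f S \<Longrightarrow> S' \<subseteq> S \<Longrightarrow> holomorphic3_on f S'"
  by (auto simp: holomorphic3_on_def)

lemma holomorphic3_on_imp_continuous_on:
  "holomorphic3_on f S \<Longrightarrow> continuous_on S f"
  unfolding holomorphic3_on_def
  by (meson continuous_at_imp_continuous_on has_derivative_continuous)

text \<open>With \<open>\<phi> = inverse\<close> this shape covers the gluings, with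
  \<open>\<phi>\<close> the identity the changes of frame, so one holomorphy lemma serves
  both.\<close>

definition fibrewise_linear ::
    "(complex \<Rightarrow> complex) \<Rightarrow> (complex \<Rightarrow> complex) \<Rightarrow> (complex \<Rightarrow> complex) \<Rightarrow>
     (complex \<Rightarrow> complex) \<Rightarrow> (complex \<Rightarrow> complex) \<Rightarrow> c3 \<Rightarrow> c3" where
  "fibrewise_linear \<phi> a b c d =
     (\<lambda>(z, u1, u2). (\<phi> z, a z * u1 + b z * u2, c z * u1 + d z * u2))"

lemma holomorphic3_on_fibrewise_linear:
  assumes "\<phi> holomorphic_on Z" "a holomorphic_on Z" "b holomorphic_on Z"
    "c holomorphic_on Z" "d holomorphic_on Z" "open Z"
  shows "holomorphic3_on (fibrewise_linear \<phi> a b c d) {x. fst x \<in> Z}"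
  unfolding holomorphic3_on_def
proof
  fix p :: c3 assume "p \<in> {x. fst x \<in> Z}"
  then have z: "fst p \<in> Z" by simp
  have ex: "\<exists>f'. ((\<lambda>x::c3. f (fst x)) has_derivative (\<lambda>h. f' * fst h)) (at p)"
    if "f holomorphic_on Z" for f
  proof -
    have "f field_differentiable (at (fst p))"
      using that assms(6) z holomorphic_on_imp_differentiable_at by blast
    then obtain f' where "(f has_derivative (*) f') (at (fst p))"
      unfolding field_differentiable_def has_field_derivative_def by blast
    from has_derivative_compose[OF has_derivative_fst[OF has_derivative_ident] this]
    show ?thesis by blast
  qed
  obtain \<phi>' a' b' c' d' where
    *: "((\<lambda>x::c3. \<phi> (fst x)) has_derivative (\<lambda>h. \<phi>' * fst h)) (at p)"
    "((\<lambda>x::c3. a (fst x)) has_derivative (\<lambda>h. a' * fst h)) (at p)"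
    "((\<lambda>x::c3. b (fst x)) has_derivative (\<lambda>h. b' * fst h)) (at p)"
    "((\<lambda>x::c3. c (fst x)) has_derivative (\<lambda>h. c' * fst h)) (at p)"
    "((\<lambda>x::c3. d (fst x)) has_derivative (\<lambda>h. d' * fst h)) (at p)"
    using assms(1-5)[THEN ex] by blast
  have eq: "fibrewise_linear \<phi> a b c d = (\<lambda>x. (\<phi> (fst x),
      a (fst x) * fst (snd x) + b (fst x) * snd (snd x),
      c (fst x) * fst (snd x) + d (fst x) * snd (snd x)))"
    by (auto simp: fibrewise_linear_def)
  show "\<exists>D. (fibrewise_linear \<phi> a b c d has_derivative D) (at p) \<and>
      (\<forall>k h. D (cscale k h) = cscale k (D h))"
    unfolding eq
    \<comment> \<open>The witness \<open>D\<close> stays schematic and is synthesised by the product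
      and sum rules; what remains is its complex linearity.\<close>
    by (rule exI, rule conjI, (rule derivative_intros *)+)
      (auto simp: cscale_def algebra_simps)
qed

section \<open>Isomorphisms given in charts\<close>

text \<open>The inverse \<open>U\<close> is carried along because it is needed to express a map from
  the second chart into the first.\<close>

definition chart_transition :: "(c3 \<Rightarrow> c3) \<Rightarrow> (c3 \<Rightarrow> c3) \<Rightarrow> bool" where
  "chart_transition T U \<longleftrightarrow>
     holomorphic3_on T {x. fst x \<noteq> 0} \<and> holomorphic3_on U {x. fst x \<noteq> 0} \<and>
     (\<forall>x. fst x \<noteq> 0 \<longrightarrow> fst (T x) \<noteq> 0 \<and> fst (U x) \<noteq> 0 \<and> U (T x) = x \<and> T (U x) = x)"

lemma chart_transition_equiv: "chart_transition T U \<Longrightarrow> equiv UNIV (glue_rel T)"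
  unfolding chart_transition_def by (intro equiv_glue_rel inj_on_inverseI[where g = U]) auto

lemma glued_point_eq_iff:
  "equiv UNIV (glue_rel T) \<Longrightarrow> glued_point T s = glued_point T t \<longleftrightarrow> (s, t) \<in> glue_rel T"
  unfolding glued_point_def by (rule eq_equiv_class_iff) auto

lemma glue_rel_iff:
  "(Inl x, Inl x') \<in> glue_rel T \<longleftrightarrow> x = x'"
  "(Inr y, Inr y') \<in> glue_rel T \<longleftrightarrow> y = y'"
  "(Inl x, Inr y) \<in> glue_rel T \<longleftrightarrow> fst x \<noteq> 0 \<and> y = T x"
  "(Inr y, Inl x) \<in> glue_rel T \<longleftrightarrow> fst x \<noteq> 0 \<and> y = T x"
  unfolding glue_rel_def by blast+

lemma glued_eq_range: "glued T = range (glued_point T)"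
  by (auto simp: glued_def glued_point_def quotient_def)

text \<open>The whole class is mapped and then saturated, so no representative is chosen;
  \<open>glued_map_point\<close> supplies well-definedness.\<close>

definition glued_map ::
    "(c3 \<Rightarrow> c3) \<Rightarrow> (c3 \<Rightarrow> c3) \<Rightarrow> (c3 \<Rightarrow> c3) \<Rightarrow> (c3 + c3) set \<Rightarrow> (c3 + c3) set" where
  "glued_map T' A B c = glue_rel T' `` (map_sum A B ` c)"

definition chart_compatible ::
    "(c3 \<Rightarrow> c3) \<Rightarrow> (c3 \<Rightarrow> c3) \<Rightarrow> (c3 \<Rightarrow> c3) \<Rightarrow> (c3 \<Rightarrow> c3) \<Rightarrow> bool" where
  "chart_compatible T T' A B \<longleftrightarrow> holomorphic3_on A UNIV \<and> holomorphic3_on B UNIV \<and>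
     (\<forall>x. fst x \<noteq> 0 \<longrightarrow> fst (A x) \<noteq> 0 \<and> T' (A x) = B (T x))"

text \<open>Compatibility sends related points to related points, so all members of a class
  contribute the same target class to the union.\<close>

lemma glued_map_point:
  assumes T: "chart_transition T U" and T': "chart_transition T' U'" and AB: "chart_compatible T T' A B"
  shows "glued_map T' A B (glued_point T s) = glued_point T' (map_sum A B s)"
proof -
  note eq = glued_point_eq_iff[OF chart_transition_equiv[OF T']]
  have cong: "glue_rel T' `` {map_sum A B t} = glue_rel T' `` {map_sum A B s}"
    if "(s, t) \<in> glue_rel T" for t
  proof -
    have "(map_sum A B t, map_sum A B s) \<in> glue_rel T'"
      using that AB by (cases s; cases t) (auto simp: glue_rel_iff chart_compatible_def)
    then show ?thesis using eq unfolding glued_point_def by blast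
  qed
  have "glued_map T' A B (glued_point T s) =
      (\<Union>t \<in> glued_point T s. glue_rel T' `` {map_sum A B t})"
    unfolding glued_map_def by (subst Image_eq_UN) simp
  also have "\<dots> = glued_point T' (map_sum A B s)"
    unfolding glued_point_def[of T']
  proof (rule SUP_eq_const)
    show "glued_point T s \<noteq> {}" by (auto simp: glued_point_def glue_rel_def)
  qed (simp add: cong glued_point_def)
  finally show ?thesis .
qed

text \<open>Holomorphy evaluates a map only at classes of points. This matters for
  \<open>inv_into\<close>, which is under control only on the glued space.\<close>

lemma holomorphic_map_cong:
  assumes "holomorphic_map T T' F" and "\<And>s. F (glued_point T s) = G (glued_point T s)"
  shows "holomorphic_map T T' G"
  using assms unfolding holomorphic_map_def glued_eq_range by (simp add: image_image)

text \<open>The four local expressions are \<open>A\<close>, \<open>T'\<close> after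
  \<open>A\<close>, \<open>U'\<close> after \<open>B\<close>, and \<open>B\<close>. The mixed ones
  live where the image has nonzero base coordinate, which is open by continuity.\<close>

lemma holomorphic_map_glued_map:
  assumes T: "chart_transition T U" and T': "chart_transition T' U'" and AB: "chart_compatible T T' A B"
  shows "holomorphic_map T T' (glued_map T' A B)"
proof -
  note pt = glued_map_point[OF T T' AB]
  note eq = glued_point_eq_iff[OF chart_transition_equiv[OF T']]
  have A: "holomorphic3_on A UNIV" and B: "holomorphic3_on B UNIV"
    using AB by (auto simp: chart_compatible_def)
  have hol: "holomorphic3_on T' {x. fst x \<noteq> 0}" "holomorphic3_on U' {x. fst x \<noteq> 0}"
    and inv: "\<And>x. fst x \<noteq> 0 \<Longrightarrow> fst (T' x) \<noteq> 0" "\<And>x. fst x \<noteq> 0 \<Longrightarrow> fst (U' x) \<noteq> 0"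
      "\<And>x. fst x \<noteq> 0 \<Longrightarrow> U' (T' x) = x" "\<And>x. fst x \<noteq> 0 \<Longrightarrow> T' (U' x) = x"
    using T' by (auto simp: chart_transition_def)
  have open_fst: "open {x. fst (f x) \<noteq> 0}" if "holomorphic3_on f UNIV" for f
    by (intro open_Collect_neq continuous_intros holomorphic3_on_imp_continuous_on that)
  have comp: "holomorphic3_on (\<lambda>x. g (f x)) {x. fst (f x) \<noteq> 0}"
    if "holomorphic3_on f UNIV" "holomorphic3_on g {x. fst x \<noteq> 0}" for f g
    by (rule holomorphic3_on_compose[OF holomorphic3_on_subset[OF that(1)] that(2)]) auto
  define P where "P i j \<longleftrightarrow> (let S = {x. \<exists>y. glued_map T' A B (glued_point T (i x)) = glued_point T' (j y)}
        in open S \<and> (\<exists>f. holomorphic3_on f S \<and>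
              (\<forall>x\<in>S. glued_map T' A B (glued_point T (i x)) = glued_point T' (j (f x)))))" for i j
  \<comment> \<open>If the gluing relation between image and target chart is the graph of
    \<open>f\<close> over \<open>S\<close>, then \<open>S\<close> is the domain in question and
    \<open>f\<close> the local expression.\<close>
  have PI: "P i j" if "\<And>x y. (map_sum A B (i x), j y) \<in> glue_rel T' \<longleftrightarrow> x \<in> S \<and> y = f x"
    "open S" "holomorphic3_on f S" for i j S f
  proof -
    have "{x. \<exists>y. glued_map T' A B (glued_point T (i x)) = glued_point T' (j y)} = S"
      by (auto simp: pt eq that(1))
    then show ?thesis unfolding P_def Let_def using that by (auto simp: pt eq)
  qed
  have "P Inl Inl"
    by (rule PI[where S = UNIV and f = A]) (auto simp: glue_rel_iff A)
  moreover have "P Inl Inr"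
    by (rule PI[where S = "{x. fst (A x) \<noteq> 0}" and f = "\<lambda>x. T' (A x)"])
      (simp_all add: glue_rel_iff open_fst A comp hol)
  moreover have "P Inr Inl"
  \<comment> \<open>Here the relation reads \<open>B x = T' y\<close> with
    \<open>fst y \<noteq> 0\<close>, which \<open>U'\<close> solves for \<open>y\<close>.\<close>
  proof (rule PI[where S = "{x. fst (B x) \<noteq> 0}" and f = "\<lambda>x. U' (B x)"])
    show "(map_sum A B (Inr x), Inl y) \<in> glue_rel T' \<longleftrightarrow>
        x \<in> {x. fst (B x) \<noteq> 0} \<and> y = U' (B x)" for x y
      unfolding map_sum.simps glue_rel_iff using inv(1,3)[of y] inv(2,4)[of "B x"] by auto
  qed (simp_all add: open_fst B comp hol)
  moreover have "P Inr Inr"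
    by (rule PI[where S = UNIV and f = B]) (auto simp: glue_rel_iff B)
  ultimately have "\<forall>i\<in>{Inl, Inr}. \<forall>j\<in>{Inl, Inr}. P i j" by blast
  then show ?thesis unfolding holomorphic_map_def P_def by (auto simp: glued_eq_range pt)
qed

lemma biholomorphism_glued_map:
  assumes T: "chart_transition T U" and T': "chart_transition T' U'"
    and AB: "chart_compatible T T' A B" and AB': "chart_compatible T' T A' B'"
    and inv: "\<And>x. A' (A x) = x" "\<And>x. A (A' x) = x" "\<And>x. B' (B x) = x" "\<And>x. B (B' x) = x"
  shows "biholomorphism T T' (glued_map T' A B)"
proof -
  let ?F = "glued_map T' A B" and ?G = "glued_map T A' B'"
  note pt = glued_map_point[OF T T' AB] and pt' = glued_map_point[OF T' T AB']
  have sum: "map_sum A' B' (map_sum A B s) = s" "map_sum A B (map_sum A' B' s) = s" for s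
    by (cases s; simp add: inv)+
  have bij: "bij_betw ?F (glued T) (glued T')"
    by (rule bij_betw_byWitness[where f' = ?G]) (auto simp: glued_eq_range pt pt' sum)
  have "?G c = inv_into (glued T) ?F c" if "c \<in> glued T'" for c
    using that by (intro inv_into_f_eq[symmetric] bij_betw_imp_inj_on[OF bij])
      (auto simp: glued_eq_range pt pt' sum)
  then have "holomorphic_map T' T (inv_into (glued T) ?F)"
    by (intro holomorphic_map_cong[OF holomorphic_map_glued_map[OF T' T AB']])
      (auto simp: glued_eq_range)
  then show ?thesis
    unfolding biholomorphism_def using bij holomorphic_map_glued_map[OF T T' AB] by blast
qed

text \<open>Since \<open>A\<close> and \<open>B\<close> fix the base coordinate, their matrices at
  \<open>z\<close> are the required fibre matrices in the two charts.\<close>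

lemma bundle_isomorphic_glued_map:
  assumes T: "chart_transition T U" and T': "chart_transition T' U'"
    and AB: "chart_compatible T T' A B" and AB': "chart_compatible T' T A' B'"
    and inv: "\<And>x. A' (A x) = x" "\<And>x. A (A' x) = x" "\<And>x. B' (B x) = x" "\<And>x. B (B' x) = x"
    and A: "A = fibrewise_linear (\<lambda>z. z) a b c d" and B: "B = fibrewise_linear (\<lambda>z. z) p q r s"
  shows "bundle_isomorphic T T'"
  unfolding bundle_isomorphic_def
proof (intro exI conjI)
  show "biholomorphism T T' (glued_map T' A B)"
    using biholomorphism_glued_map[OF T T' AB AB' inv] .
  show "\<forall>i\<in>{Inl, Inr}. \<forall>z. \<exists>a b c d. \<forall>u1 u2.
        glued_map T' A B (glued_point T (i (z, u1, u2))) =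
        glued_point T' (i (z, a * u1 + b * u2, c * u1 + d * u2))"
    unfolding glued_map_point[OF T T' AB] by (auto simp: A B fibrewise_linear_def)
qed

section \<open>Lower triangular gluings\<close>

definition lower_triangular :: "int \<Rightarrow> int \<Rightarrow> (complex \<Rightarrow> complex) \<Rightarrow> c3 \<Rightarrow> c3" where
  "lower_triangular m n h =
     fibrewise_linear inverse (\<lambda>z. z powi m) (\<lambda>z. 0) h (\<lambda>z. z powi n)"

text \<open>Inverting the matrix with rows \<open>(z powi m, 0)\<close> and
  \<open>(h z, z powi n)\<close> and substituting the inverse base coordinate restores the exponents
  \<open>m\<close> and \<open>n\<close>; only the corner entry changes.\<close>

lemma chart_transition_lower_triangular:
  assumes "h holomorphic_on - {0}"
  shows "chart_transition (lower_triangular m n h)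
    (lower_triangular m n (\<lambda>z. - (z powi (m + n) * h (inverse z))))"
proof -
  have [simp]: "- {0} = {z :: complex. z \<noteq> 0}" by auto
  have "(\<lambda>z. h (inverse z)) holomorphic_on - {0}"
    by (rule holomorphic_on_compose_gen[OF _ assms, unfolded o_def])
      (auto intro!: holomorphic_intros)
  then have hol: "(\<lambda>z. - (z powi (m + n) * h (inverse z))) holomorphic_on - {0}"
    by (intro holomorphic_intros) auto
  have hol3: "holomorphic3_on (lower_triangular m n k) {x. fst x \<noteq> 0}"
    if "k holomorphic_on - {0}" for k
  proof -
    have "holomorphic3_on (lower_triangular m n k) {x. fst x \<in> - {0}}"
      unfolding lower_triangular_def
      by (intro holomorphic3_on_fibrewise_linear holomorphic_intros that open_Compl closed_singleton)
        auto
    then show ?thesis by simp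
  qed
  show ?thesis
    unfolding chart_transition_def using hol3[OF assms] hol3[OF hol]
    by (auto simp: lower_triangular_def fibrewise_linear_def power_int_inverse power_int_add
        field_simps)
qed

lemma bundle_isomorphic_lower_triangular_refl:
  assumes "h holomorphic_on - {0}"
  shows "bundle_isomorphic (lower_triangular m n h) (lower_triangular m n h)"
proof -
  have id: "fibrewise_linear (\<lambda>z. z) (\<lambda>z. 1) (\<lambda>z. 0) (\<lambda>z. 0) (\<lambda>z. 1) = (\<lambda>x. x)"
    by (auto simp: fibrewise_linear_def)
  have "chart_compatible T T (\<lambda>x. x) (\<lambda>x. x)" for T
    unfolding chart_compatible_def holomorphic3_on_def using has_derivative_ident by blast
  then show ?thesis
    using chart_transition_lower_triangular[OF assms]
    by (intro bundle_isomorphic_glued_map[where A = "\<lambda>x. x" and B = "\<lambda>x. x" and A' = "\<lambda>x. x"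
        and B' = "\<lambda>x. x"]) (auto simp: id[symmetric])
qed

text \<open>Taking the exponents \<open>m\<close> and \<open>n\<close> as naturals encodes the
  bounds on \<open>r\<close> and makes the entries \<open>z ^ m\<close> and \<open>z ^ n\<close>
  holomorphic also at 0.\<close>

lemma bundle_isomorphic_perturbed:
  fixes m n M :: nat
  assumes m: "int m = int M - r" and n: "int n = int M + r"
  shows "bundle_isomorphic
    (lower_triangular (1 - int M) (int M + 1) (\<lambda>z. z powi (r + 1)))
    (lower_triangular (1 - r) (r + 1) (\<lambda>z. 0))"
proof -
  let ?T = "lower_triangular (1 - int M) (int M + 1) (\<lambda>z. z powi (r + 1))"
  let ?T' = "lower_triangular (1 - r) (r + 1) (\<lambda>z. 0)"
  let ?A = "fibrewise_linear (\<lambda>z. z) (\<lambda>z. 0) (\<lambda>z. - 1) (\<lambda>z. 1) (\<lambda>z. z ^ m)"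
  let ?A' = "fibrewise_linear (\<lambda>z. z) (\<lambda>z. z ^ m) (\<lambda>z. 1) (\<lambda>z. - 1) (\<lambda>z. 0)"
  let ?B = "fibrewise_linear (\<lambda>z. z) (\<lambda>z. 1) (\<lambda>z. - (z ^ n)) (\<lambda>z. 0) (\<lambda>z. 1)"
  let ?B' = "fibrewise_linear (\<lambda>z. z) (\<lambda>z. 1) (\<lambda>z. z ^ n) (\<lambda>z. 0) (\<lambda>z. 1)"
  have hol: "holomorphic3_on (fibrewise_linear (\<lambda>z. z) a b c d) UNIV"
    if "a holomorphic_on UNIV" "b holomorphic_on UNIV" "c holomorphic_on UNIV" "d holomorphic_on UNIV"
    for a b c d
    using holomorphic3_on_fibrewise_linear[OF holomorphic_on_ident that] by simp
  have A: "holomorphic3_on ?A UNIV" and A': "holomorphic3_on ?A' UNIV"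
    and B: "holomorphic3_on ?B UNIV" and B': "holomorphic3_on ?B' UNIV"
    by (intro hol holomorphic_intros)+
  have inv: "?A' (?A x) = x" "?A (?A' x) = x" "?B' (?B x) = x" "?B (?B' x) = x" for x
    by (auto simp: fibrewise_linear_def algebra_simps split: prod.splits)
  \<comment> \<open>Integer powers allow exponents to be collected. The second identity has
    \<open>inverse z\<close> because \<open>?B\<close> is evaluated over the base point
    \<open>inverse z\<close>.\<close>
  have pow: "z ^ m = z powi (int M - r)" "inverse z ^ n = z powi (- int M - r)"
    if "z \<noteq> 0" for z :: complex
  proof -
    show "z ^ m = z powi (int M - r)" unfolding m[symmetric] by simp
    have "inverse z ^ n = z powi (- int n)" by (simp add: power_int_minus power_inverse)
    also have "- int n = - int M - r" using n by simp
    finally show "inverse z ^ n = z powi (- int M - r)" .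
  qed
  \<comment> \<open>The second component is
    \<open>v2 = \<gamma> powi (r + 1) * (w1 + \<gamma> ^ m * w2)\<close>. In the first, subtracting
    \<open>\<beta> ^ n * v2\<close> from \<open>v1\<close> cancels \<open>w1\<close> and leaves
    \<open>- (\<gamma> powi (1 - r) * w2)\<close>.\<close>
  have comm: "?T' (?A x) = ?B (?T x)" if "fst x \<noteq> 0" for x
    using that by (cases x) (auto simp: lower_triangular_def fibrewise_linear_def pow algebra_simps
        simp flip: power_int_add mult.assoc)
  have AB: "chart_compatible ?T ?T' ?A ?B"
    using A B comm unfolding chart_compatible_def by (auto simp: fibrewise_linear_def)
  \<comment> \<open>No second computation: \<open>comm\<close> is applied at \<open>?A' x\<close>
    and \<open>?B'\<close> undoes \<open>?B\<close>.\<close>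
  have "?T (?A' x) = ?B' (?T' x)" if "fst x \<noteq> 0" for x
  proof -
    have "fst (?A' x) \<noteq> 0" using that by (auto simp: fibrewise_linear_def split: prod.splits)
    from comm[OF this] show ?thesis by (metis inv)
  qed
  then have AB': "chart_compatible ?T' ?T ?A' ?B'"
    using A' B' unfolding chart_compatible_def by (auto simp: fibrewise_linear_def)
  have T: "chart_transition ?T
      (lower_triangular (1 - int M) (int M + 1)
        (\<lambda>z. - (z powi (1 - int M + (int M + 1)) * inverse z powi (r + 1))))"
    by (intro chart_transition_lower_triangular holomorphic_intros) auto
  have T': "chart_transition ?T'
      (lower_triangular (1 - r) (r + 1) (\<lambda>z. - (z powi (1 - r + (r + 1)) * 0)))"
    by (intro chart_transition_lower_triangular holomorphic_intros)
  show ?thesis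
    by (rule bundle_isomorphic_glued_map[OF T T' AB AB' inv refl refl])
qed

lemma ferrari_gluing_lower_triangular:
  "ferrari_gluing M (\<lambda>z w. h z * w) = lower_triangular (1 - int M) (int M + 1) h"
  by (auto simp: ferrari_gluing_def lower_triangular_def fibrewise_linear_def)

lemma direct_sum_lower_triangular:
  "direct_sum (line_bundle m) (line_bundle n) = lower_triangular (- m) (- n) (\<lambda>z. 0)"
  by (auto simp: direct_sum_def line_bundle_def lower_triangular_def fibrewise_linear_def)

section \<open>Potentials\<close>

text \<open>The powers of \<open>\<gamma>\<close> combine to exponent \<open>- (M - r)\<close>, so
  the residue is a coefficient of half the square of \<open>p\<close>, computed by the Cauchy
  product.\<close>

lemma matrix_potential_quadratic:
  assumes "r \<le> M"
  shows "matrix_potential M (\<lambda>i. if i = int r + 1 then [:0, 0, 1 / 2:] else 0) =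
    (\<lambda>x. 1 / 2 * (\<Sum>i=1..M - r. x i * x (M - r + 1 - i)))"
proof
  fix x :: "nat \<Rightarrow> complex"
  define p where "p = (\<lambda>z. \<Sum>i=1..M. x i * z ^ (i - 1))"
  define P where "P = (\<Sum>i=1..M. fps_const (x i) * fps_X ^ (i - 1))"
  have "p has_fps_expansion P"
    unfolding p_def P_def by (intro fps_expansion_intros)
  then have exp: "(\<lambda>z. 1 / 2 * (p z * p z)) has_fps_expansion fps_const (1 / 2) * (P * P)"
    by (intro fps_expansion_intros)
  \<comment> \<open>Beyond degree \<open>M - 1\<close> the coefficients of \<open>P\<close> vanish,
    hence the bound; the product below only uses degrees up to \<open>M - r - 1\<close>.\<close>
  have nth: "fps_nth P k = x (k + 1)" if "k < M" for k
  proof -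
    have "fps_nth P k = (\<Sum>i=1..M. if i = k + 1 then x i else 0)"
      unfolding P_def fps_sum_nth by (rule sum.cong) (auto simp: fps_X_power_nth)
    then show ?thesis using that by simp
  qed
  have "residue (\<lambda>z. 1 / 2 * (p z * p z) / z ^ (M - r)) 0 =
      1 / 2 * (\<Sum>i=1..M - r. x i * x (M - r + 1 - i))"
  proof (cases "M - r")
    \<comment> \<open>For \<open>r = M\<close> there is no pole, and the sum is empty.\<close>
    case 0
    have "(\<lambda>z. 1 / 2 * (p z * p z)) holomorphic_on UNIV"
      unfolding p_def by (intro holomorphic_intros)
    then show ?thesis using 0 residue_holo[of UNIV 0] by simp
  next
    case (Suc n)
    have "residue (\<lambda>z. 1 / 2 * (p z * p z) / z ^ Suc n) 0 = fps_nth (fps_const (1 / 2) * (P * P)) n"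
      by (rule residue_fps_expansion_over_power_at_0[OF exp])
    also have "\<dots> = 1 / 2 * (\<Sum>i=0..n. fps_nth P i * fps_nth P (n - i))"
      by (simp only: fps_mult_left_const_nth fps_mult_nth[of P])
    also have "(\<Sum>i=0..n. fps_nth P i * fps_nth P (n - i)) = (\<Sum>i=0..n. x (i + 1) * x (n - i + 1))"
      using Suc by (intro sum.cong) (auto simp: nth)
    also have "\<dots> = (\<Sum>i=1..Suc n. x i * x (Suc n + 1 - i))"
      by (rule sum.reindex_bij_witness[of _ "\<lambda>i. i - 1" Suc]) (auto simp: Suc_diff_le)
    finally show ?thesis using Suc by simp
  qed
  moreover have "z powi (- int M - 1) * (1 / 2 * (p z * p z) * z powi (int r + 1)) =
      1 / 2 * (p z * p z) / z ^ (M - r)" if "z \<noteq> 0" for z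
  proof -
    have "z powi (- int M - 1) * z powi (int r + 1) = z powi (- int (M - r))"
      using that assms by (simp flip: power_int_add)
    also have "\<dots> = inverse (z ^ (M - r))" by (simp add: power_int_minus)
    finally show ?thesis by (simp add: field_simps)
  qed
  \<comment> \<open>The residue ignores the value at 0, so the identity for
    \<open>z \<noteq> 0\<close> suffices.\<close>
  then have "residue (\<lambda>z. z powi (- int M - 1) * (1 / 2 * (p z * p z) * z powi (int r + 1))) 0 =
      residue (\<lambda>z. 1 / 2 * (p z * p z) / z ^ (M - r)) 0"
    by (intro residue_cong) (auto simp: eventually_at_filter)
  moreover have "{i. (if i = int r + 1 then [:0, 0, 1 / 2:] else 0) \<noteq> (0 :: complex poly)} = {int r + 1}"
    by auto
  moreover have "poly [:0, 0, 1 / 2:] w = 1 / 2 * (w * w)" for w :: complex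
    by (simp add: algebra_simps)
  moreover have "(\<Sum>i=1..M. x i * z ^ (i - 1)) = p z" for z
    by (simp add: p_def)
  ultimately show "matrix_potential M (\<lambda>i. if i = int r + 1 then [:0, 0, 1 / 2:] else 0) x =
      1 / 2 * (\<Sum>i=1..M - r. x i * x (M - r + 1 - i))"
    unfolding matrix_potential_def potential_value_def by simp
qed

lemma matrix_potential_zero: "matrix_potential M (\<lambda>i. 0) = (\<lambda>x. 0)"
  by (rule ext) (simp add: matrix_potential_def potential_value_def residue_const)

lemma geometry_zero: "geometry M (\<lambda>i. 0) = ferrari_gluing M (\<lambda>\<gamma> w1. 0)"
proof -
  have "potential_value (\<lambda>i. 0) \<gamma> = (\<lambda>w. 0)" for \<gamma>
    by (rule ext) (simp add: potential_value_def)
  then show ?thesis by (simp add: geometry_def)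
qed

lemma geometry_quadratic:
  "geometry M (\<lambda>i. if i = k then [:0, 0, 1 / 2:] else 0) = ferrari_gluing M (\<lambda>\<gamma> w1. \<gamma> powi k * w1)"
proof -
  have "{i. (if i = k then [:0, 0, 1 / 2:] else 0) \<noteq> (0 :: complex poly)} = {k}" by auto
  moreover have "deriv (\<lambda>w. poly [:0, 0, 1 / 2:] w * c) = (\<lambda>w. c * w)" for c :: complex
    by (rule ext, rule DERIV_imp_deriv) (auto intro!: derivative_eq_intros simp: field_simps)
  ultimately show ?thesis unfolding geometry_def potential_value_def by simp
qed

theorem proposition1:
  fixes M :: nat and r :: int
  assumes "M \<ge> 1" and "- int M \<le> r" and "r \<le> int M"
  shows "bundle_isomorphic (ferrari_gluing M (\<lambda>\<gamma> w1. 0))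
           (direct_sum (line_bundle (int M - 1)) (line_bundle (- int M - 1)))
       \<and> bundle_isomorphic (ferrari_gluing M (\<lambda>\<gamma> w1. \<gamma> powi (r + 1) * w1))
           (direct_sum (line_bundle (r - 1)) (line_bundle (- r - 1)))
       \<and> (r \<ge> 0 \<longrightarrow>
           geometrically_equivalent
             M (\<lambda>x. 1 / 2 * (\<Sum>i=1..M - nat r. x i * x (M - nat r + 1 - i)))
             (nat r) (\<lambda>x. 0))"
proof (intro conjI impI)
  \<comment> \<open>An equality of gluing maps, stated for all \<open>N\<close>: it serves at
    \<open>M\<close> for the first claim and at \<open>nat r\<close> for the zero potential.\<close>
  have unperturbed: "ferrari_gluing N (\<lambda>\<gamma> w1. 0) =
      direct_sum (line_bundle (int N - 1)) (line_bundle (- int N - 1))" for N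
    using ferrari_gluing_lower_triangular[of N "\<lambda>z. 0"] by (simp add: direct_sum_lower_triangular add.commute)
  show "bundle_isomorphic (ferrari_gluing M (\<lambda>\<gamma> w1. 0))
           (direct_sum (line_bundle (int M - 1)) (line_bundle (- int M - 1)))"
    unfolding unperturbed direct_sum_lower_triangular
    by (intro bundle_isomorphic_lower_triangular_refl holomorphic_intros)
  show perturbed: "bundle_isomorphic (ferrari_gluing M (\<lambda>\<gamma> w1. \<gamma> powi (r + 1) * w1))
           (direct_sum (line_bundle (r - 1)) (line_bundle (- r - 1)))"
    using bundle_isomorphic_perturbed[of "nat (int M - r)" M r "nat (int M + r)"] assms
    by (simp add: ferrari_gluing_lower_triangular direct_sum_lower_triangular add.commute)
  assume r: "r \<ge> 0"
  let ?E = "\<lambda>i. if i = int (nat r) + 1 then [:0, 0, 1 / 2:] else (0 :: complex poly)"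
  have "geometric_potential ?E"
    unfolding geometric_potential_def by (rule finite_subset[of _ "{int (nat r) + 1}"]) auto
  \<comment> \<open>The direct sum reached from the perturbed bundle is the geometry of the zero
    potential in \<open>nat r\<close> variables; forgetting fibrewise linearity leaves a
    biholomorphism.\<close>
  moreover have "biholomorphic (geometry M ?E) (geometry (nat r) (\<lambda>i. 0))"
    using perturbed r unfolding geometry_quadratic geometry_zero unperturbed
    by (auto simp: bundle_isomorphic_def biholomorphic_def)
  moreover have "nat r \<le> M" using assms by simp
  ultimately show "geometrically_equivalent
      M (\<lambda>x. 1 / 2 * (\<Sum>i=1..M - nat r. x i * x (M - nat r + 1 - i))) (nat r) (\<lambda>x. 0)"
    unfolding geometrically_equivalent_def
    by (rule_tac x = ?E in exI, rule_tac x = "\<lambda>i. 0" in exI, intro conjI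
      matrix_potential_quadratic matrix_potential_zero) (simp_all add: geometric_potential_def)
qed

end
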